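(* Let $p$ be a prime and let $n,t$ be positive integers. The group $\mathrm{RC}_n(\mathbb{F}_{p^t}) \cap \mathrm{SL}_n(\mathbb{F}_{p^t})$ has index $p^t-1$ in $\mathrm{RC}_n(\mathbb{F}_{p^t})$. In particular, there are exactly $|\mathrm{RC}_n(\mathbb{F}_{p^t})| \cdot (p^t-1)^{-1}$ circulant $(n \times n)$-matrices of determinant $1$ over $\mathbb{F}_{p^t}$.
   Context: A matrix $(a_{i,j})_{1 \leq i,j \leq n}$ is called circulant if $a_{i,j+1} = a_{i-1,j}$ for all $1 \leq i,j \leq n$, where indices are read modulo $n$. $\mathrm{RC}_n(\mathbb{F}_{p^t})$ denotes the group (under matrix multiplication) of regular, i.e. invertible, circulant $(n\times n)$-matrices over $\mathbb{F}_{p^t}$. *)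

theory Defs
  imports
    "Jordan_Normal_Form.Determinant"
    "HOL-Algebra.Coset"
    "HOL-Library.Cardinality"
begin

text \<open>The paper's condition is \<open>a\<^bsub>i,j+1\<^esub> = a\<^bsub>i-1,j\<^esub>\<close> with indices modulo \<open>n\<close>. It is invariant
  under shifting both indices, so it reads the same for the 0-based indices used here;
  \<open>(i + n - 1) mod n\<close> is the residue of \<open>i - 1\<close>, avoiding truncated subtraction at \<open>i = 0\<close>.\<close>

definition circulant_mat :: "'a mat \<Rightarrow> bool" where
  "circulant_mat A \<longleftrightarrow> square_mat A \<and>
     (let n = dim_row A in
       \<forall>i<n. \<forall>j<n. A $$ (i, (j + 1) mod n) = A $$ ((i + n - 1) mod n, j))"

definition RC :: "nat \<Rightarrow> 'a :: field mat monoid" where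
  "RC n = \<lparr>carrier = {A \<in> carrier_mat n n. circulant_mat A \<and> invertible_mat A},
           monoid.mult = (*), one = 1\<^sub>m n\<rparr>"

definition SL :: "nat \<Rightarrow> 'a :: field mat set" where
  "SL n = {A \<in> carrier_mat n n. det A = 1}"

definition subgroup_index :: "('a, 'b) monoid_scheme \<Rightarrow> 'a set \<Rightarrow> nat" where
  "subgroup_index G H = card (rcosets\<^bsub>G\<^esub> H)"

end

theory Submission
  imports Defs "HOL-Number_Theory.Residues"
begin

text \<open>The circulant matrices are the centralizer of the cyclic shift, so the invertible ones form
  a group. The group \<open>RC\<^sub>n \<inter> SL\<^sub>n\<close> is the kernel of the determinant, so everything reduces to showing that
  the determinant maps \<open>RC\<^sub>n\<close> onto the nonzero scalars. Write \<open>n = p\<^sup>k m\<close> with \<open>p\<close> not dividing \<open>m\<close>,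
  and let \<open>B\<close> be the circulant 0-1 matrix of the congruence modulo \<open>d = p\<^sup>k\<close>. Sylvester's identity
  gives \<open>det (1 + b B) = (1 + b m)\<^sup>d\<close>; here \<open>m\<close> is nonzero in the field, so \<open>1 + b m\<close> is
  arbitrary, and every element of a finite field of characteristic \<open>p\<close> is a \<open>p\<^sup>k\<close>-th power.\<close>

section \<open>The group of invertible circulant matrices\<close>

lemma invertible_mat_iff_det_nonzero:
  fixes A :: "'a :: field mat"
  assumes A: "A \<in> carrier_mat n n"
  shows "invertible_mat A \<longleftrightarrow> det A \<noteq> 0"
proof
  assume "invertible_mat A"
  then obtain B where AB: "A * B = 1\<^sub>m n" and BA: "B * A = 1\<^sub>m (dim_row B)"
    using A by (auto simp: invertible_mat_def inverts_mat_def)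
  \<comment> \<open>\<open>invertible_mat\<close> leaves the shape of \<open>B\<close> open;
    counting columns in \<open>A * B\<close> and in \<open>B * A\<close> fixes its two
    dimensions.\<close>
  have "B \<in> carrier_mat n n"
    using arg_cong[OF AB, of dim_col] arg_cong[OF BA, of dim_col] A by auto
  then show "det A \<noteq> 0" using arg_cong[OF AB, of det] det_mult[OF A] by auto
next
  assume "det A \<noteq> 0"
  \<comment> \<open>\<open>undefined\<close> only fills the extension slot of the record
    \<open>ring_mat\<close>.\<close>
  from det_non_zero_imp_unit[OF A this, of undefined] A show "invertible_mat A"
    unfolding invertible_mat_def inverts_mat_def Units_def ring_mat_def by auto
qed

definition shift_mat :: "nat \<Rightarrow> 'a :: semiring_1 mat" where
  "shift_mat n = mat n n (\<lambda>(i, j). of_bool (i = (j + 1) mod n))"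

lemma shift_mat_carrier [simp]: "shift_mat n \<in> carrier_mat n n"
  by (simp add: shift_mat_def)

lemma mod_succ_eq_iff_mod_pred_eq:
  fixes i j n :: nat
  assumes "i < n" "j < n"
  shows "i = (j + 1) mod n \<longleftrightarrow> j = (i + n - 1) mod n"
  using assms by (cases "j + 1 = n"; cases i) (auto simp: mod_if)

text \<open>Right multiplication by the shift puts column j + 1 in place j, left multiplication puts
  row i - 1 in place i, so the entries of the two products are the two sides of the circulant
  condition.\<close>

lemma circulant_mat_iff_commute_shift:
  fixes A :: "'a :: semiring_1 mat"
  assumes A: "A \<in> carrier_mat n n"
  shows "circulant_mat A \<longleftrightarrow> A * shift_mat n = shift_mat n * A"
proof -
  have right: "(A * shift_mat n) $$ (i, j) = A $$ (i, (j + 1) mod n)" if "i < n" "j < n" for i j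
  proof -
    have "(A * shift_mat n) $$ (i, j) = (\<Sum>k = 0..<n. if k = (j + 1) mod n then A $$ (i, k) else 0)"
      using A that by (auto simp: shift_mat_def scalar_prod_def intro!: sum.cong)
    also have "\<dots> = A $$ (i, (j + 1) mod n)" using that by simp
    finally show ?thesis .
  qed
  have left: "(shift_mat n * A) $$ (i, j) = A $$ ((i + n - 1) mod n, j)" if "i < n" "j < n" for i j
  proof -
    have "(shift_mat n * A) $$ (i, j) = (\<Sum>k = 0..<n. if k = (i + n - 1) mod n then A $$ (k, j) else 0)"
      using A that mod_succ_eq_iff_mod_pred_eq[of i n]
      by (auto simp: shift_mat_def scalar_prod_def intro!: sum.cong)
    also have "\<dots> = A $$ ((i + n - 1) mod n, j)" using that by simp
    finally show ?thesis .
  qed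
  have "A * shift_mat n = shift_mat n * A \<longleftrightarrow>
    (\<forall>i<n. \<forall>j<n. (A * shift_mat n) $$ (i, j) = (shift_mat n * A) $$ (i, j))"
    using A carrier_matD[OF shift_mat_carrier[of n, where ?'a = 'a]]
    by (auto simp del: index_mult_mat(1) intro!: eq_matI)
  then show ?thesis using A by (auto simp: circulant_mat_def Let_def left right)
qed

text \<open>Commuting with a fixed matrix and having nonzero determinant both pass to products and
  inverses, which gives the group axioms.\<close>

lemma carrier_RC_iff:
  "A \<in> carrier (RC n) \<longleftrightarrow> A \<in> carrier_mat n n \<and> A * shift_mat n = shift_mat n * A \<and> det A \<noteq> 0"
  by (auto simp: RC_def circulant_mat_iff_commute_shift invertible_mat_iff_det_nonzero)

lemma RC_mult [simp]: "A \<otimes>\<^bsub>RC n\<^esub> B = A * B"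
  and RC_one [simp]: "\<one>\<^bsub>RC n\<^esub> = 1\<^sub>m n"
  by (simp_all add: RC_def)

lemma group_RC: "group (RC n :: 'a :: field mat monoid)"
proof (rule groupI)
  fix A B :: "'a mat" assume "A \<in> carrier (RC n)" "B \<in> carrier (RC n)"
  then have A: "A \<in> carrier_mat n n" and B: "B \<in> carrier_mat n n"
    and cA: "A * shift_mat n = shift_mat n * A" and cB: "B * shift_mat n = shift_mat n * B"
    and "det A \<noteq> 0" "det B \<noteq> 0" by (auto simp: carrier_RC_iff)
  have "(A * B) * shift_mat n = A * (shift_mat n * B)"
    using A B by (simp add: cB[symmetric] assoc_mult_mat[OF A B shift_mat_carrier])
  also have "\<dots> = shift_mat n * (A * B)"
    using assoc_mult_mat[OF A shift_mat_carrier B] assoc_mult_mat[OF shift_mat_carrier A B] cA by simp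
  finally show "A \<otimes>\<^bsub>RC n\<^esub> B \<in> carrier (RC n)"
    using A B \<open>det A \<noteq> 0\<close> \<open>det B \<noteq> 0\<close> by (auto simp: carrier_RC_iff det_mult)
next
  show "\<one>\<^bsub>RC n\<^esub> \<in> carrier (RC n :: 'a mat monoid)"
    by (simp add: carrier_RC_iff left_mult_one_mat[OF shift_mat_carrier]
        right_mult_one_mat[OF shift_mat_carrier])
next
  fix A :: "'a mat" assume "A \<in> carrier (RC n)"
  then have A: "A \<in> carrier_mat n n" and cA: "A * shift_mat n = shift_mat n * A"
    and "det A \<noteq> 0" by (auto simp: carrier_RC_iff)
  from det_non_zero_imp_unit[OF A \<open>det A \<noteq> 0\<close>, of undefined]
  obtain B where B: "B \<in> carrier_mat n n" and BA: "B * A = 1\<^sub>m n" and AB: "A * B = 1\<^sub>m n"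
    by (auto simp: Units_def ring_mat_def)
  note S = shift_mat_carrier[of n, where ?'a = 'a]
  \<comment> \<open>With S the shift, inserting \<open>A * B\<close> = 1 lets \<open>A\<close> move
    past S and cancel: BS = BSAB = BASB = SB.\<close>
  have "B * shift_mat n = B * (shift_mat n * (A * B))"
    by (simp add: AB right_mult_one_mat[OF S])
  also have "\<dots> = B * (A * shift_mat n * B)"
    using assoc_mult_mat[OF S A B] cA by simp
  also have "\<dots> = (B * A) * (shift_mat n * B)"
    using assoc_mult_mat[OF A S B] assoc_mult_mat[OF B A, of "shift_mat n * B" n] S B by simp
  also have "\<dots> = shift_mat n * B"
    using left_mult_one_mat[OF mult_carrier_mat[OF S B]] by (simp add: BA)
  finally have "B * shift_mat n = shift_mat n * B" .
  moreover have "det B \<noteq> 0" using arg_cong[OF BA, of det] det_mult[OF B A] by auto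
  ultimately show "\<exists>B\<in>carrier (RC n). B \<otimes>\<^bsub>RC n\<^esub> A = \<one>\<^bsub>RC n\<^esub>"
    using B BA by (auto simp: carrier_RC_iff)
qed (auto simp: carrier_RC_iff)

section \<open>The determinant as a homomorphism\<close>

definition nonzero_scalars :: "'a :: field monoid" where
  "nonzero_scalars = \<lparr>carrier = - {0}, monoid.mult = (*), one = 1\<rparr>"

lemma nonzero_scalars_simps [simp]:
  "carrier nonzero_scalars = - {0}" "x \<otimes>\<^bsub>nonzero_scalars\<^esub> y = x * y" "\<one>\<^bsub>nonzero_scalars\<^esub> = 1"
  by (simp_all add: nonzero_scalars_def)

lemma group_nonzero_scalars: "group (nonzero_scalars :: 'a :: field monoid)"
proof (rule groupI)
  fix x :: 'a assume "x \<in> carrier nonzero_scalars"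
  then show "\<exists>y\<in>carrier nonzero_scalars. y \<otimes>\<^bsub>nonzero_scalars\<^esub> x = \<one>\<^bsub>nonzero_scalars\<^esub>"
    by (intro bexI[of _ "inverse x"]) auto
qed (auto simp: mult.assoc)

lemma order_nonzero_scalars:
  "order (nonzero_scalars :: 'a :: {field, finite} monoid) = CARD('a) - 1"
  by (simp add: order_def card_Diff_singleton Compl_eq_Diff_UNIV)

lemma group_hom_det:
  "group_hom (RC n) (nonzero_scalars :: 'a :: field monoid) det"
proof (intro group_hom.intro group_hom_axioms.intro group_RC group_nonzero_scalars homI)
qed (auto simp: carrier_RC_iff det_mult)

lemma kernel_det: "kernel (RC n) nonzero_scalars det = carrier (RC n) \<inter> SL n"
  by (auto simp: kernel_def SL_def carrier_RC_iff)

section \<open>Surjectivity of the determinant\<close>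

text \<open>Sylvester's identity: \<open>?Y * ?L\<close> and \<open>?L * ?Z\<close> are the same
  block matrix, all three factors are block triangular, and \<open>?L\<close> has determinant
  1.\<close>

lemma det_one_add_mult_commute:
  fixes U :: "'a :: idom mat"
  assumes U: "U \<in> carrier_mat n d" and V: "V \<in> carrier_mat d n"
  shows "det (1\<^sub>m n + U * V) = det (1\<^sub>m d + V * U)"
proof -
  let ?L = "four_block_mat (1\<^sub>m n) (0\<^sub>m n d) V (1\<^sub>m d)"
  let ?Y = "four_block_mat (1\<^sub>m n + U * V) (- U) (0\<^sub>m d n) (1\<^sub>m d)"
  let ?Z = "four_block_mat (1\<^sub>m n) (- U) (0\<^sub>m d n) (1\<^sub>m d + V * U)"
  have "?Y * ?L = four_block_mat (1\<^sub>m n) (- U) V (1\<^sub>m d)"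
  proof -
    have "1\<^sub>m n + U * V + - U * V = 1\<^sub>m n" using U V by auto
    then show ?thesis using U V
      by (subst mult_four_block_mat[where ?nr1.0 = n and ?n1.0 = n and ?n2.0 = d and ?nr2.0 = d
            and ?nc1.0 = n and ?nc2.0 = d]) auto
  qed
  moreover have "?L * ?Z = four_block_mat (1\<^sub>m n) (- U) V (1\<^sub>m d)"
  proof -
    have "V * - U + (1\<^sub>m d + V * U) = 1\<^sub>m d" using U V by auto
    then show ?thesis using U V
      by (subst mult_four_block_mat[where ?nr1.0 = n and ?n1.0 = n and ?n2.0 = d and ?nr2.0 = d
            and ?nc1.0 = n and ?nc2.0 = d]) auto
  qed
  ultimately have "det (?Y * ?L) = det (?L * ?Z)"
    by simp
  then show ?thesis using U V
    by (simp add: det_mult[of _ "n + d"] det_four_block_mat_lower_left_zero[of _ n _ d]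
        det_four_block_mat_upper_right_zero[of _ n _ d])
qed

definition cong_mat :: "nat \<Rightarrow> nat \<Rightarrow> 'a :: semiring_1 mat" where
  "cong_mat n d = mat n n (\<lambda>(i, j). of_bool ([i = j] (mod d)))"

text \<open>As \<open>d\<close> divides \<open>n\<close>, reducing an index modulo \<open>n\<close>
  preserves its residue modulo \<open>d\<close>, so i = j + 1 and i - 1 = j are the same
  congruence.\<close>

lemma circulant_mat_one_add_smult_cong_mat:
  fixes b :: "'a :: semiring_1"
  assumes "d dvd n"
  shows "circulant_mat (1\<^sub>m n + b \<cdot>\<^sub>m cong_mat n d)"
proof -
  have "[i = (j + 1) mod n] (mod d) \<longleftrightarrow> [(i + n - 1) mod n = j] (mod d)" if "i < n" for i j
  proof -
    have "[i = (j + 1) mod n] (mod d) \<longleftrightarrow> [i + n = j + 1] (mod d)"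
      using assms by (auto simp: cong_def mod_mod_cancel elim!: dvdE)
    \<comment> \<open>Here i < n makes n positive, so the subtraction is not truncated and the 1 can
      be cancelled.\<close>
    also have "\<dots> \<longleftrightarrow> [(i + n - 1) + 1 = j + 1] (mod d)" using that by simp
    also have "\<dots> \<longleftrightarrow> [(i + n - 1) mod n = j] (mod d)"
      using assms by (simp only: cong_add_rcancel_nat) (simp add: cong_def mod_mod_cancel)
    finally show ?thesis .
  qed
  then show ?thesis
    using mod_succ_eq_iff_mod_pred_eq[of _ n]
    by (auto simp: circulant_mat_def cong_mat_def Let_def)
qed

lemma card_residue_class_lessThan:
  fixes i d m :: nat
  assumes "i < d"
  shows "card {k. k < d * m \<and> k mod d = i} = m"
proof -
  have "{k. k < d * m \<and> k mod d = i} = (\<lambda>q. d * q + i) ` {..<m}"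
  proof (intro equalityI subsetI)
    fix k assume k: "k \<in> {k. k < d * m \<and> k mod d = i}"
    then have "k = d * (k div d) + i" using mult_div_mod_eq[of d k] by simp
    moreover have "k div d < m"
      using k by (simp add: less_mult_imp_div_less mult.commute)
    ultimately show "k \<in> (\<lambda>q. d * q + i) ` {..<m}" by blast
  next
    fix k assume "k \<in> (\<lambda>q. d * q + i) ` {..<m}"
    then obtain q where q: "k = d * q + i" "q < m" by auto
    have "d * q + i < d * Suc q" using assms by simp
    also have "\<dots> \<le> d * m" using q by (intro mult_le_mono2) simp
    finally show "k \<in> {k. k < d * m \<and> k mod d = i}" using q assms by simp
  qed
  moreover have "inj_on (\<lambda>q. d * q + i) {..<m}" using assms by (auto simp: inj_on_def)
  ultimately show ?thesis by (simp add: card_image)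
qed

text \<open>The matrix factors through the \<open>d\<close> residue classes as \<open>U * V\<close>,
  with \<open>b\<close> absorbed into \<open>V\<close>. Each class has \<open>m\<close> members, so
  \<open>V * U\<close> is the scalar matrix \<open>b * of_nat m\<close> of size \<open>d\<close>,
  whose determinant is immediate.\<close>

lemma det_one_add_smult_cong_mat:
  fixes b :: "'a :: idom"
  assumes d: "d > 0" and n: "n = d * m"
  shows "det (1\<^sub>m n + b \<cdot>\<^sub>m cong_mat n d) = (1 + b * of_nat m) ^ d"
proof -
  define U where "U = mat n d (\<lambda>(i, j). of_bool (i mod d = j) :: 'a)"
  define V where "V = mat d n (\<lambda>(i, j). b * of_bool (j mod d = i))"
  have U: "U \<in> carrier_mat n d" and V: "V \<in> carrier_mat d n" by (simp_all add: U_def V_def)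
  have UV: "U * V = b \<cdot>\<^sub>m cong_mat n d"
  proof (rule eq_matI)
    fix i j assume "i < dim_row (b \<cdot>\<^sub>m cong_mat n d)" "j < dim_col (b \<cdot>\<^sub>m cong_mat n d)"
    then have ij: "i < n" "j < n" by (auto simp: cong_mat_def)
    have "(U * V) $$ (i, j) = (\<Sum>k = 0..<d. if k = i mod d then b * of_bool (j mod d = k) else 0)"
      using ij by (auto simp: U_def V_def scalar_prod_def intro!: sum.cong)
    also have "\<dots> = b * of_bool (j mod d = i mod d)" using d by simp
    finally show "(U * V) $$ (i, j) = (b \<cdot>\<^sub>m cong_mat n d) $$ (i, j)"
      using ij by (auto simp: cong_mat_def cong_def)
  qed (auto simp: U_def V_def cong_mat_def)
  have VU: "V * U = (b * of_nat m) \<cdot>\<^sub>m 1\<^sub>m d"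
  proof (rule eq_matI)
    fix i j assume "i < dim_row ((b * of_nat m) \<cdot>\<^sub>m 1\<^sub>m d)" "j < dim_col ((b * of_nat m) \<cdot>\<^sub>m 1\<^sub>m d)"
    then have ij: "i < d" "j < d" by auto
    have "(V * U) $$ (i, j) = (\<Sum>k = 0..<n. b * of_bool (i = j) * of_bool (k mod d = i))"
      using ij by (auto simp: U_def V_def scalar_prod_def intro!: sum.cong)
    also have "\<dots> = b * of_bool (i = j) * of_nat (card ({0..<n} \<inter> {k. k mod d = i}))"
      by (simp add: sum_distrib_left[symmetric])
    also have "{0..<n} \<inter> {k. k mod d = i} = {k. k < d * m \<and> k mod d = i}" using n by auto
    finally show "(V * U) $$ (i, j) = ((b * of_nat m) \<cdot>\<^sub>m 1\<^sub>m d) $$ (i, j)"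
      using ij by (simp add: card_residue_class_lessThan)
  qed (auto simp: U_def V_def)
  have "1\<^sub>m d + V * U = (1 + b * of_nat m) \<cdot>\<^sub>m 1\<^sub>m d"
    unfolding VU by (rule eq_matI) auto
  with det_one_add_mult_commute[OF U V] show ?thesis by (simp add: UV)
qed

section \<open>Prime-power roots and the characteristic of a finite field\<close>

lemma power_CARD_eq_self:
  fixes x :: "'a :: {field, finite}"
  shows "x ^ CARD('a) = x"
proof (cases "x = 0")
  case False
  interpret group "nonzero_scalars :: 'a monoid" by (rule group_nonzero_scalars)
  have pow: "x [^]\<^bsub>nonzero_scalars\<^esub> k = x ^ k" for k :: nat
    by (induction k) (simp_all add: mult.commute)
  have "x ^ (CARD('a) - 1) = 1"
    using pow_order_eq_1[of x] False by (simp add: pow order_nonzero_scalars)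
  then have "x * x ^ (CARD('a) - 1) = x" by simp
  then show ?thesis by (simp flip: power_Suc)
qed simp

text \<open>Iterating x^q = x with q = p^t gives c^(p^(tk)) = c. Since t > 0, tk \<ge> k, so
  c^(p^(tk - k)) is a root.\<close>

lemma finite_field_prime_power_root:
  fixes c :: "'a :: {field, finite}"
  assumes card: "CARD('a) = p ^ t" and "t > 0"
  obtains a where "a ^ (p ^ k) = c"
proof -
  have iter: "c ^ (p ^ (t * l)) = c" for l
    by (induction l) (simp_all add: power_add power_mult power_CARD_eq_self flip: card)
  have "p ^ (t * k) = p ^ (t * k - k) * p ^ k"
    using \<open>t > 0\<close> by (simp flip: power_add)
  then have "(c ^ (p ^ (t * k - k))) ^ (p ^ k) = c" using iter[of k] by (simp flip: power_mult)
  then show ?thesis by (rule that)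
qed

text \<open>The characteristic is a prime dividing the order p^t of the field.\<close>

lemma CHAR_eq_prime:
  fixes p t :: nat
  assumes "prime p" and "CARD('a :: {field, finite}) = p ^ t"
  shows "CHAR('a) = p"
proof -
  have "prime CHAR('a)" by (intro prime_CHAR_semidom finite_imp_CHAR_pos) simp
  moreover have "CHAR('a) dvd p ^ t" using CHAR_dvd_CARD[where ?'a = 'a] assms(2) by simp
  ultimately show ?thesis using assms(1) prime_dvd_power primes_dvd_imp_eq by blast
qed

lemma det_image_RC:
  fixes p n t :: nat
  assumes "prime p" "n > 0" "t > 0" "CARD('a :: {field, finite}) = p ^ t"
  shows "det ` carrier (RC n) = - {0 :: 'a}"
proof (intro equalityI subsetI)
  fix c :: 'a assume "c \<in> - {0}"
  have "n \<noteq> 0" "\<not> is_unit p" using assms by auto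
  from multiplicity_decompose'[OF this]
  obtain m where m: "n = p ^ multiplicity p n * m" "\<not> p dvd m" by auto
  define d where "d = p ^ multiplicity p n"
  \<comment> \<open>The characteristic is \<open>p\<close>, which does not divide
    \<open>m\<close>.\<close>
  have m0: "of_nat m \<noteq> (0 :: 'a)"
    using m(2) CHAR_eq_prime[where ?'a = 'a] assms by (simp add: of_nat_eq_0_iff_char_dvd)
  obtain a :: 'a where a: "a ^ d = c"
    unfolding d_def using finite_field_prime_power_root[OF assms(4,3)] by blast
  \<comment> \<open>The coefficient b solves 1 + b m = a, so the determinant is a^d = c.\<close>
  let ?A = "1\<^sub>m n + ((a - 1) / of_nat m) \<cdot>\<^sub>m cong_mat n d"
  have n: "n = d * m" "d > 0" using m assms by (auto simp: d_def prime_gt_0_nat)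
  have det: "det ?A = c" using n m0 a by (simp add: det_one_add_smult_cong_mat)
  have A: "?A \<in> carrier_mat n n" by (simp add: cong_mat_def)
  have "circulant_mat ?A" by (rule circulant_mat_one_add_smult_cong_mat) (simp add: n)
  then have "?A \<in> carrier (RC n)"
    using A det \<open>c \<in> - {0}\<close> by (simp add: carrier_RC_iff circulant_mat_iff_commute_shift)
  then show "c \<in> det ` carrier (RC n)" using det by blast
qed (auto simp: carrier_RC_iff)

theorem corollary1p3:
  fixes p n t :: nat
    and G :: "'a :: {field, finite} mat monoid"
  assumes "prime p" and "n > 0" and "t > 0"
    and "CARD('a) = p ^ t"
    and "G = RC n"
  shows "group G
    \<and> subgroup (carrier G \<inter> SL n) G
    \<and> subgroup_index G (carrier G \<inter> SL n) = p ^ t - 1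
    \<and> real (card {A :: 'a mat. A \<in> carrier_mat n n \<and> circulant_mat A \<and> det A = 1})
           = real (order G) * inverse (real (p ^ t - 1))"
proof -
  interpret det: group_hom G "nonzero_scalars :: 'a monoid" det
    unfolding \<open>G = RC n\<close> by (rule group_hom_det)
  let ?H = "carrier G \<inter> SL n"
  have ker: "kernel G nonzero_scalars det = ?H" by (simp add: \<open>G = RC n\<close> kernel_det)
  have sub: "subgroup ?H G" using det.subgroup_kernel by (simp add: ker)
  have "det ` carrier G = carrier nonzero_scalars"
    using det_image_RC[where ?'a = 'a] assms by simp
  \<comment> \<open>First isomorphism theorem: the cosets of the kernel are in bijection with the
    p^t - 1 nonzero scalars.\<close>
  from det.FactGroup_iso_set[OF this]
  have "card (carrier (G Mod ?H)) = order (nonzero_scalars :: 'a monoid)"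
    unfolding ker order_def by (auto simp: iso_def intro: bij_betw_same_card)
  then have index: "card (rcosets\<^bsub>G\<^esub> ?H) = p ^ t - 1"
    using assms(4) by (simp add: FactGroup_def order_nonzero_scalars)
  \<comment> \<open>Determinant 1 already forces invertibility.\<close>
  have "{A :: 'a mat. A \<in> carrier_mat n n \<and> circulant_mat A \<and> det A = 1} = ?H"
    by (auto simp: \<open>G = RC n\<close> carrier_RC_iff SL_def circulant_mat_iff_commute_shift)
  moreover have "real (card ?H) * real (p ^ t - 1) = real (order G)"
    using det.G.lagrange[OF sub] index by (simp only: flip: of_nat_mult) (simp add: mult.commute)
  \<comment> \<open>Makes p^t - 1 nonzero, so that Lagrange's equation can be divided by it.\<close>
  moreover have "p ^ t > 1" using prime_gt_1_nat[OF assms(1)] assms(3) by (rule one_less_power)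
  then have "real (p ^ t - 1) \<noteq> 0" by (simp only: of_nat_eq_0_iff)
  ultimately have "real (card {A :: 'a mat. A \<in> carrier_mat n n \<and> circulant_mat A \<and> det A = 1})
      = real (order G) * inverse (real (p ^ t - 1))"
    by (metis divide_inverse nonzero_eq_divide_eq)
  then show ?thesis using sub index det.G.group_axioms by (simp add: subgroup_index_def)
qed

end
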